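(* Let $n \ge 1$ and let $i$ be an integer with $(3^n+1)/2 \le i \le (5 \cdot 3^n - 3)/6$. Write $$i = \frac{3^n+1}{2} + i_0 + i_1 \cdot 3 + i_2 \cdot 3^2 + \cdots + i_{n-2} \cdot 3^{n-2}$$ with digits $i_t \in \{0,1,2\}$ for $0 \le t \le n-2$. This is possible since $(5\cdot 3^n - 3)/6 - (3^n+1)/2 = 2 + 2\cdot 3 + \cdots + 2 \cdot 3^{n-2}$. Then the following statements are equivalent: (i) $\binom{3i - \frac{3^n-1}{2}}{i - \frac{3^n+1}{2}} \not\equiv 0 \pmod 3$; (ii) $2 \ge i_0 \ge i_1 \ge \cdots \ge i_{n-2} \ge 0$; (iii) $i = \frac{3^n+1}{2} + \frac{3^j - 1}{2} + \frac{3^k - 1}{2}$ for some integers $0 \le j \le k \le n-1$. *)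

theory Defs
  imports "HOL-Number_Theory.Number_Theory"
begin

text \<open>The indices \<open>0, \<dots>, n - 2\<close> are written \<open>t < n - 1\<close>, so that for
  \<open>n = 1\<close> there are none. All divisions below are exact.\<close>

definition digit_expansion :: "nat \<Rightarrow> nat \<Rightarrow> (nat \<Rightarrow> nat) \<Rightarrow> bool" where
  "digit_expansion n i d \<longleftrightarrow>
     (\<forall>t < n - 1. d t \<in> {0, 1, 2}) \<and>
     i = (3 ^ n + 1) div 2 + (\<Sum>t < n - 1. d t * 3 ^ t)"

end

(* Put N = n - 1 and m = i - (3^n + 1)/2 < 3^N, with ternary digits d_0, ..., d_{N-1}. The upper entry of the
   binomial coefficient is then 3^(N+1) + 3m + 2, whose digits are 2, d_0, ..., d_{N-1}, 1. By Lucas the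
   coefficient is congruent to (2 choose d_0) (d_0 choose d_1) ... (d_{N-2} choose d_{N-1}), which is a unit
   iff the digits descend. Descending digits are those of the form [t < j] + [t < k], and
   (3^j - 1)/2 has j digits equal to 1. *)
theory Submission
  imports Defs
begin

text \<open>This is (1 + X)^p = 1 + X^p modulo p, multiplied by (1 + X)^x and read off at X^k: in
  Vandermonde's sum only the terms with \<open>j = 0\<close> and \<open>j = p\<close>
  survive.\<close>

lemma prime_add_choose_cong:
  fixes p :: nat
  assumes "prime p"
  shows "[(p + x) choose k = (x choose k) + (if p \<le> k then x choose (k - p) else 0)] (mod p)"
proof -
  let ?f = "\<lambda>j. (p choose j) * (x choose (k - j))"
  have p0: "p > 0" using assms prime_gt_0_nat by blast
  have dvd: "p dvd p choose j" if "j \<in> {..k} - {0, p}" for j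
  proof (cases "j < p")
    case True
    with that show ?thesis using assms by (intro dvd_choose_prime) auto
  qed (use that in \<open>auto simp: binomial_eq_0\<close>)
  \<comment> \<open>Since \<open>p > 0\<close>, the two indices differ and no term is counted twice;
    the index \<open>p\<close> lies in the range exactly when \<open>p \<le> k\<close>.\<close>
  have "[(\<Sum>j\<le>k. ?f j) =
      (\<Sum>j\<le>k. (if j = 0 then ?f j else 0) + (if j = p then ?f j else 0))] (mod p)"
    by (rule cong_sum) (use dvd p0 in \<open>auto simp: cong_0_iff\<close>)
  moreover have "(\<Sum>j\<le>k. (if j = 0 then ?f j else 0) + (if j = p then ?f j else 0)) =
      (x choose k) + (if p \<le> k then x choose (k - p) else 0)"
    by (simp add: sum.distrib)
  ultimately show ?thesis by (simp only: vandermonde)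
qed

text \<open>One digit of Lucas' theorem, by induction on \<open>a\<close>: raising \<open>a\<close>
  by one adds \<open>p\<close> to the upper entry, and the preceding congruence then plays the role
  of Pascal's rule for \<open>a choose b\<close>.\<close>

lemma lucas_cong:
  fixes p :: nat
  assumes "prime p" "r < p" "s < p"
  shows "[(p * a + r) choose (p * b + s) = (a choose b) * (r choose s)] (mod p)"
proof (induction a arbitrary: b)
  case 0
  show ?case
  proof (cases b)
    case (Suc b')
    \<comment> \<open>The lower entry exceeds the upper one, so both sides vanish.\<close>
    then have "r < p * b + s" using assms by simp
    then show ?thesis using Suc by (simp add: binomial_eq_0)
  qed simp
next
  case (Suc a)
  have step: "[(p * Suc a + r) choose (p * b + s) = ((p * a + r) choose (p * b + s)) +
      (if p \<le> p * b + s then (p * a + r) choose (p * b + s - p) else 0)] (mod p)"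
    using prime_add_choose_cong[OF assms(1), of "p * a + r" "p * b + s"] by (simp add: add.assoc)
  show ?case
  proof (cases b)
    case 0
    with step Suc.IH[of 0] assms show ?thesis by (auto intro: cong_trans)
  next
    case (Suc b')
    have "[(p * a + r choose (p * b + s)) + (p * a + r choose (p * b' + s)) =
        (a choose b) * (r choose s) + (a choose b') * (r choose s)] (mod p)"
      by (intro cong_add Suc.IH)
    with step show ?thesis using \<open>b = Suc b'\<close>
      by (auto simp: algebra_simps intro: cong_trans)
  qed
qed

text \<open>For \<open>k \<le> c\<close> the coefficient divides \<open>fact c\<close>, a product of
  numbers below \<open>p\<close>; for \<open>k > c\<close> it is 0.\<close>

lemma prime_dvd_choose_iff:
  fixes p :: nat
  assumes "prime p" "c < p"
  shows "p dvd c choose k \<longleftrightarrow> c < k"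
proof (cases "c < k")
  case False
  then have "(c choose k) dvd fact c"
    by (metis binomial_fact_lemma dvd_triv_right not_less)
  moreover have "\<not> p dvd fact c"
    using assms by (simp add: prime_dvd_fact_iff)
  ultimately show ?thesis
    using False dvd_trans by blast
qed (simp add: binomial_eq_0)

text \<open>In the induction the lowest digit is removed from both entries; the lowest digit of the lower
  entry then becomes the new \<open>c\<close>.\<close>

lemma prime_dvd_shifted_choose_iff:
  fixes p :: nat and d :: "nat \<Rightarrow> nat"
  assumes "prime p" "c < p" "\<forall>t<N. d t < p"
  defines "m \<equiv> (\<Sum>t<N. d t * p ^ t)"
  shows "\<not> p dvd (p ^ Suc N + p * m + c) choose m \<longleftrightarrow>
    (N > 0 \<longrightarrow> d 0 \<le> c) \<and> (\<forall>t. Suc t < N \<longrightarrow> d (Suc t) \<le> d t)"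
  using assms(2,3) unfolding m_def
proof (induction N arbitrary: c d)
  case 0
  show ?case using assms(1) by (auto simp: prime_nat_iff)
next
  case (Suc N)
  define E where "E = (\<Sum>t<N. d (Suc t) * p ^ t)"
  have expand: "(\<Sum>t<Suc N. d t * p ^ t) = p * E + d 0"
    unfolding E_def sum.lessThan_Suc_shift by (simp add: sum_distrib_left algebra_simps)
  \<comment> \<open>After removal of the lowest digit \<open>c\<close> the upper entry has the same
    shape again, with \<open>E\<close> for the lower entry and \<open>d 0\<close> for
    \<open>c\<close>.\<close>
  have top: "p ^ Suc (Suc N) + p * (p * E + d 0) + c = p * (p ^ Suc N + p * E + d 0) + c"
    by (simp add: algebra_simps)
  have d0: "d 0 < p" using Suc.prems by simp
  have "p dvd (p * (p ^ Suc N + p * E + d 0) + c) choose (p * E + d 0) \<longleftrightarrow>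
      p dvd ((p ^ Suc N + p * E + d 0) choose E) * (c choose d 0)"
    using cong_dvd_iff lucas_cong[OF assms(1) Suc.prems(1) d0] by blast
  also have "\<dots> \<longleftrightarrow> p dvd (p ^ Suc N + p * E + d 0) choose E \<or> c < d 0"
    using assms(1) Suc.prems by (simp add: prime_dvd_mult_iff prime_dvd_choose_iff)
  also have "p dvd (p ^ Suc N + p * E + d 0) choose E \<longleftrightarrow>
      \<not> ((N > 0 \<longrightarrow> d 1 \<le> d 0) \<and> (\<forall>t. Suc t < N \<longrightarrow> d (Suc (Suc t)) \<le> d (Suc t)))"
    using Suc.IH[of "d 0" "\<lambda>t. d (Suc t)", folded E_def] d0 Suc.prems(2) by fastforce
  \<comment> \<open>The boundary comparison of the shifted digits is the case \<open>t = 0\<close>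
    of the unshifted chain.\<close>
  also have "(N > 0 \<longrightarrow> d 1 \<le> d 0) \<and> (\<forall>t. Suc t < N \<longrightarrow> d (Suc (Suc t)) \<le> d (Suc t)) \<longleftrightarrow>
      (\<forall>t. Suc t < Suc N \<longrightarrow> d (Suc t) \<le> d t)"
  proof (intro iffI conjI allI impI)
    fix t
    assume *: "(N > 0 \<longrightarrow> d 1 \<le> d 0) \<and> (\<forall>t. Suc t < N \<longrightarrow> d (Suc (Suc t)) \<le> d (Suc t))"
    assume "Suc t < Suc N"
    with * show "d (Suc t) \<le> d t" by (cases t) auto
  qed auto
  finally show ?case unfolding expand top by auto
qed

lemma digits_exist:
  fixes b m :: nat
  assumes "m < b ^ N"
  shows "\<exists>d. (\<forall>t<N. d t < b) \<and> m = (\<Sum>t<N. d t * b ^ t)"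
  using assms
proof (induction N arbitrary: m)
  case (Suc N)
  have b: "b > 0" using Suc.prems by (cases b) auto
  have "m div b < b ^ N" using Suc.prems by (simp add: less_mult_imp_div_less mult.commute)
  then obtain d where d: "\<forall>t<N. d t < b" "m div b = (\<Sum>t<N. d t * b ^ t)"
    using Suc.IH by blast
  \<comment> \<open>The remainder is put in front as the new lowest digit.\<close>
  let ?d = "case_nat (m mod b) d"
  have "(\<Sum>t<Suc N. ?d t * b ^ t) = m mod b + b * (m div b)"
    unfolding d(2) sum.lessThan_Suc_shift by (simp add: sum_distrib_left algebra_simps)
  then show ?case using d(1) b by (intro exI[of _ ?d]) (auto split: nat.split)
qed simp

lemma digits_unique:
  fixes b :: nat and d e :: "nat \<Rightarrow> nat"
  assumes "\<forall>t<N. d t < b" "\<forall>t<N. e t < b" "(\<Sum>t<N. d t * b ^ t) = (\<Sum>t<N. e t * b ^ t)"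
  shows "\<forall>t<N. d t = e t"
  using assms
proof (induction N arbitrary: d e)
  case (Suc N)
  have expand: "(\<Sum>t<Suc N. f t * b ^ t) = f 0 + b * (\<Sum>t<N. f (Suc t) * b ^ t)" for f
    unfolding sum.lessThan_Suc_shift by (simp add: sum_distrib_left algebra_simps)
  have lt: "d 0 < b" "e 0 < b" using Suc.prems by auto
  have eq: "d 0 + b * (\<Sum>t<N. d (Suc t) * b ^ t) = e 0 + b * (\<Sum>t<N. e (Suc t) * b ^ t)"
    using Suc.prems(3) unfolding expand .
  from arg_cong[OF eq, of "\<lambda>x. x mod b"] lt have "d 0 = e 0" by simp
  moreover from arg_cong[OF eq, of "\<lambda>x. x div b"] lt
  have "(\<Sum>t<N. d (Suc t) * b ^ t) = (\<Sum>t<N. e (Suc t) * b ^ t)" by simp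
  then have "\<forall>t<N. d (Suc t) = e (Suc t)" using Suc.prems by (intro Suc.IH) auto
  ultimately show ?case by (auto simp: less_Suc_eq_0_disj)
qed simp

lemma sum_indicator_powers:
  fixes b :: nat
  assumes "k \<le> N"
  shows "(\<Sum>t<N. of_bool (t < k) * b ^ t) = (\<Sum>t<k. b ^ t)"
  using assms by (intro sum.mono_neutral_cong_right) auto

lemma sum_powers_three: "(\<Sum>t<k. 3 ^ t) = (3 ^ k - 1) div (2::nat)"
proof -
  have "2 * (\<Sum>t<k. 3 ^ t) + 1 = (3::nat) ^ k" by (induction k) auto
  then show ?thesis by simp
qed

text \<open>The positions whose digit is at least \<open>c\<close> form an initial segment;
  \<open>k\<close> is the first position outside it, or \<open>N\<close> if there is none.\<close>

lemma antimono_digits_threshold: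
  fixes d :: "nat \<Rightarrow> nat"
  assumes "\<forall>t. Suc t < N \<longrightarrow> d (Suc t) \<le> d t"
  obtains k where "k \<le> N" "\<forall>t<N. c \<le> d t \<longleftrightarrow> t < k"
proof -
  have anti: "d t \<le> d s" if "s \<le> t" "t < N" for s t
    using that by (induction t rule: dec_induct) (use assms le_trans in auto)
  define k where "k = (LEAST t. t \<ge> N \<or> d t < c)"
  have k: "k \<ge> N \<or> d k < c" unfolding k_def by (rule LeastI[of _ N]) simp
  have "k \<le> N" unfolding k_def by (rule Least_le) simp
  moreover have "c \<le> d t \<longleftrightarrow> t < k" if "t < N" for t
  proof
    assume "c \<le> d t"
    with anti[of k t] k that show "t < k" by force
  next
    assume "t < k"
    then show "c \<le> d t" unfolding k_def using that not_less_Least by fastforce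
  qed
  ultimately show ?thesis using that by blast
qed

text \<open>Here \<open>k\<close> counts the nonzero digits and \<open>j\<close> the digits equal to
  2. Conversely, the value determines the digits, and a sum of two initial-segment indicators
  descends.\<close>

lemma antimono_ternary_iff:
  fixes d :: "nat \<Rightarrow> nat"
  assumes "\<forall>t<N. d t < 3"
  shows "(\<forall>t. Suc t < N \<longrightarrow> d (Suc t) \<le> d t) \<longleftrightarrow>
    (\<exists>j k. j \<le> k \<and> k \<le> N \<and>
      (\<Sum>t<N. d t * 3 ^ t) = (3 ^ j - 1) div 2 + (3 ^ k - 1) div 2)"
proof -
  let ?e = "\<lambda>j k t. of_bool (t < j) + of_bool (t < k) :: nat"
  have value_e: "(\<Sum>t<N. ?e j k t * 3 ^ t) = (3 ^ j - 1) div 2 + (3 ^ k - 1) div 2"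
    if "j \<le> k" "k \<le> N" for j k
    using that
    by (simp only: add_mult_distrib sum.distrib sum_indicator_powers sum_powers_three order_trans)
  show ?thesis
  proof
    assume mono: "\<forall>t. Suc t < N \<longrightarrow> d (Suc t) \<le> d t"
    obtain k where k: "k \<le> N" "\<forall>t<N. 1 \<le> d t \<longleftrightarrow> t < k"
      using antimono_digits_threshold[OF mono] .
    obtain j where j: "j \<le> N" "\<forall>t<N. 2 \<le> d t \<longleftrightarrow> t < j"
      using antimono_digits_threshold[OF mono] .
    have "j \<le> k"
    proof (rule ccontr)
      assume "\<not> j \<le> k"
      \<comment> \<open>Position \<open>k\<close> would carry a digit that is at least 2 but not at
        least 1.\<close>
      then have "k < N" "2 \<le> d k" using j by auto
      then show False using k(2) by auto
    qed
    \<comment> \<open>A digit below 3 equals the number of thresholds 1 and 2 that it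
      reaches.\<close>
    moreover have "d t = ?e j k t" if "t < N" for t
      using j(2) k(2) assms that by (cases "t < j"; cases "t < k") force+
    then have "(\<Sum>t<N. d t * 3 ^ t) = (\<Sum>t<N. ?e j k t * 3 ^ t)" by simp
    ultimately show "\<exists>j k. j \<le> k \<and> k \<le> N \<and>
        (\<Sum>t<N. d t * 3 ^ t) = (3 ^ j - 1) div 2 + (3 ^ k - 1) div 2"
      using value_e[of j k] k(1) by (intro exI[of _ j] exI[of _ k]) simp
  next
    assume "\<exists>j k. j \<le> k \<and> k \<le> N \<and>
        (\<Sum>t<N. d t * 3 ^ t) = (3 ^ j - 1) div 2 + (3 ^ k - 1) div 2"
    then obtain j k where jk: "j \<le> k" "k \<le> N"
        "(\<Sum>t<N. d t * 3 ^ t) = (3 ^ j - 1) div 2 + (3 ^ k - 1) div 2"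
      by blast
    from jk(3) value_e[OF jk(1,2)]
    have "(\<Sum>t<N. d t * 3 ^ t) = (\<Sum>t<N. ?e j k t * 3 ^ t)"
      by (simp only:)
    then have "\<forall>t<N. d t = ?e j k t"
      using assms by (intro digits_unique[where b = 3]) auto
    then show "\<forall>t. Suc t < N \<longrightarrow> d (Suc t) \<le> d t" by auto
  qed
qed

theorem theorem4:
  fixes n i :: nat
  assumes "n \<ge> 1"
    and "(3 ^ n + 1) div 2 \<le> i"
    and "i \<le> (5 * 3 ^ n - 3) div 6"
  shows "(\<exists>d. digit_expansion n i d) \<and>
    (\<forall>d. digit_expansion n i d \<longrightarrow>
      ((\<not> [(3 * i - (3 ^ n - 1) div 2) choose (i - (3 ^ n + 1) div 2) = 0] (mod 3)) \<longleftrightarrow>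
        ((\<forall>t < n - 1. 2 \<ge> d t \<and> d t \<ge> 0) \<and> (\<forall>t. t + 1 < n - 1 \<longrightarrow> d t \<ge> d (t + 1)))) \<and>
      (((\<forall>t < n - 1. 2 \<ge> d t \<and> d t \<ge> 0) \<and> (\<forall>t. t + 1 < n - 1 \<longrightarrow> d t \<ge> d (t + 1))) \<longleftrightarrow>
        (\<exists>j k. 0 \<le> j \<and> j \<le> k \<and> k \<le> n - 1 \<and>
          i = (3 ^ n + 1) div 2 + (3 ^ j - 1) div 2 + (3 ^ k - 1) div 2)))"
proof (intro conjI allI impI)
  obtain N where n: "n = Suc N" using assms(1) by (cases n) auto
  \<comment> \<open>Exactness of the halvings makes the later computations linear in
    \<open>3 ^ n\<close>.\<close>
  have half: "2 * ((3 ^ n + 1) div 2) = (3 ^ n + 1 :: nat)"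
      "2 * ((3 ^ n - 1) div 2) = (3 ^ n - 1 :: nat)"
    by (intro dvd_mult_div_cancel; simp)+
  have digit_iff: "x \<in> {0, 1, 2} \<longleftrightarrow> x < 3" for x :: nat by auto
  \<comment> \<open>The upper bound on \<open>i\<close> minus (3^n + 1)/2 is (2 * 3^n - 6)/6 = 3^N -
    1.\<close>
  have "i - (3 ^ n + 1) div 2 < 3 ^ N"
    using assms(2,3) half by (simp add: n)
  then obtain d where "\<forall>t<N. d t < 3" "i - (3 ^ n + 1) div 2 = (\<Sum>t<N. d t * 3 ^ t)"
    using digits_exist by blast
  then have "digit_expansion n i d"
    using assms(2) unfolding digit_expansion_def digit_iff n by simp
  then show "\<exists>d. digit_expansion n i d" by blast

  fix d
  assume "digit_expansion n i d"
  then have d: "\<forall>t<N. d t < 3" and i: "i = (3 ^ n + 1) div 2 + (\<Sum>t<N. d t * 3 ^ t)"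
    unfolding digit_expansion_def digit_iff n by auto
  define m where "m = (\<Sum>t<N. d t * 3 ^ t)"
  have low: "i - (3 ^ n + 1) div 2 = m" using i by (simp add: m_def)
  \<comment> \<open>This keeps the natural-number subtraction \<open>3 ^ n - 1\<close> from being
    truncated.\<close>
  have "(3::nat) ^ n \<ge> 1" by simp
  then have top: "3 * i - (3 ^ n - 1) div 2 = 3 ^ Suc N + 3 * m + 2"
    using i half unfolding m_def[symmetric] n[symmetric] by linarith
  have descending: "(\<forall>t < n - 1. 2 \<ge> d t \<and> d t \<ge> 0) \<and> (\<forall>t. t + 1 < n - 1 \<longrightarrow> d t \<ge> d (t + 1))
      \<longleftrightarrow> (\<forall>t. Suc t < N \<longrightarrow> d (Suc t) \<le> d t)"
    using d by (auto simp: n less_Suc_eq_le numeral_3_eq_3 numeral_2_eq_2)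
  show "(\<not> [(3 * i - (3 ^ n - 1) div 2) choose (i - (3 ^ n + 1) div 2) = 0] (mod 3)) \<longleftrightarrow>
      ((\<forall>t < n - 1. 2 \<ge> d t \<and> d t \<ge> 0) \<and> (\<forall>t. t + 1 < n - 1 \<longrightarrow> d t \<ge> d (t + 1)))"
    \<comment> \<open>With \<open>c = 2\<close> the condition \<open>d 0 \<le> c\<close> holds for
      every ternary digit, so only the chain of comparisons remains.\<close>
    unfolding descending low top cong_0_iff m_def
    using prime_dvd_shifted_choose_iff[of 3 2 N d] d by fastforce
  show "((\<forall>t < n - 1. 2 \<ge> d t \<and> d t \<ge> 0) \<and> (\<forall>t. t + 1 < n - 1 \<longrightarrow> d t \<ge> d (t + 1))) \<longleftrightarrow>
      (\<exists>j k. 0 \<le> j \<and> j \<le> k \<and> k \<le> n - 1 \<and>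
        i = (3 ^ n + 1) div 2 + (3 ^ j - 1) div 2 + (3 ^ k - 1) div 2)"
    unfolding descending antimono_ternary_iff[OF d] unfolding i by (simp add: n add.assoc)
qed

end
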